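(* Assume $a(p)>0>b(p)$ for all $p\in\mathbb{R}$. For $h\in(0,+\infty]$ consider the problem of finding a pair $(c,\varphi)$, $c\in\mathbb{R}$, $\varphi$ a function on $(-1,1)$, with $$c=a(\varphi')\frac{\varphi''}{1+(\varphi')^2}+b(\varphi')\sqrt{1+(\varphi')^2}\quad\text{for }x\in(-1,1),\qquad \varphi'(-1)=-h,\quad \varphi'(1)=h. \qquad (P_h)$$ (i) If $a_0>-b_0$, then $(P_{+\infty})$ has a solution pair $(c,\varphi)=(\bar c,\Phi(x))$. In particular, $\bar c$ is unique and $0<\bar c<\frac{\pi a^0}{2}$, while $\Phi$ is unique up to a shift (i.e. up to an additive constant). (ii) If $0<h<+\infty$ satisfies $a_0h>-b_0\sqrt{1+h^2}$, then $(P_h)$ has a solution pair $(c,\varphi)=(c(h),\Phi(x;h))$. Furthermore, $c(h)$ is unique and strictly increasing in $h$, with $0<c(h)<a^0\arctan h$, while $\Phi(\cdot;h)$ is unique up to a shift (additive constant).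
   Context: Let $A$ and $-B$ be smooth positive functions on the unit circle $\mathbb{S}^1$, and for $p\in\mathbb{R}$ put $a(p)=A\big((-p,1)/\sqrt{1+p^2}\big)$ and $b(p)=B\big((-p,1)/\sqrt{1+p^2}\big)$; these are smooth bounded functions on $\mathbb{R}$. Notation: $a^0=\max a$, $a_0=\min a$, $b^0=\max b$, $b_0=\min b$, where max/min mean supremum/infimum over $\mathbb{R}$. When $h=+\infty$ the boundary conditions mean $\varphi'(x)\to\pm\infty$ as $x\to\pm1$ from inside $(-1,1)$. *)

theory Defs
  imports "HOL-Analysis.Analysis"
begin

text \<open>
  The unit circle is \<^term>\<open>sphere (0 :: real \<times> real) 1\<close> (the norm on pairs is Euclidean).  A function
  on it is \<open>C\<^sup>\<infinity>\<close> iff it is so in the angle \<open>t\<close>, since \<open>t \<mapsto> (cos t, sin t)\<close> restricted to short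
  intervals inverts the charts of the standard smooth structure.
\<close>

definition smooth_on_circle :: "(real \<times> real \<Rightarrow> real) \<Rightarrow> bool" where
  "smooth_on_circle F \<longleftrightarrow>
     (\<forall>n. \<forall>t. (deriv ^^ n) (\<lambda>s. F (cos s, sin s)) differentiable at t)"

definition graph_normal :: "real \<Rightarrow> real \<times> real" where
  "graph_normal p = (1 / sqrt (1 + p\<^sup>2)) *\<^sub>R (- p, 1)"

text \<open>
  Since \<open>\<phi>\<close> is only given on \<open>(-1,1)\<close> (its values elsewhere are irrelevant), the boundary conditions
  are one-sided limits of \<open>\<phi>'\<close> from inside.  Taken in \<^typ>\<open>ereal\<close>, they mean \<open>\<phi>' \<longlongrightarrow> \<plusminus>h\<close> for real \<open>h\<close>
  and divergence to \<open>\<plusminus>\<infinity>\<close> for \<open>h = \<infinity>\<close>.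
\<close>

definition solves_P ::
  "(real \<Rightarrow> real) \<Rightarrow> (real \<Rightarrow> real) \<Rightarrow> ereal \<Rightarrow> real \<Rightarrow> (real \<Rightarrow> real) \<Rightarrow> bool" where
  "solves_P a b h c \<phi> \<longleftrightarrow>
     (\<forall>x\<in>{-1<..<1}. \<phi> differentiable at x \<and> deriv \<phi> differentiable at x \<and>
        c = a (deriv \<phi> x) * (deriv (deriv \<phi>) x / (1 + (deriv \<phi> x)\<^sup>2))
            + b (deriv \<phi> x) * sqrt (1 + (deriv \<phi> x)\<^sup>2)) \<and>
     ((\<lambda>x. ereal (deriv \<phi> x)) \<longlongrightarrow> - h) (at_right (-1)) \<and>
     ((\<lambda>x. ereal (deriv \<phi> x)) \<longlongrightarrow> h) (at_left 1)"

definition equal_up_to_shift :: "(real \<Rightarrow> real) \<Rightarrow> (real \<Rightarrow> real) \<Rightarrow> bool" where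
  "equal_up_to_shift \<phi> \<psi> \<longleftrightarrow> (\<exists>k. \<forall>x\<in>{-1<..<1}. \<phi> x = \<psi> x + k)"

end

theory Submission
  imports Defs "HOL-Complex_Analysis.Conformal_Mappings"
begin

text \<open>
  The equation for \<open>\<phi>\<close> is an autonomous first-order equation for the slope \<open>p = \<phi>'\<close>,
  \<open>p' = (1 + p\<^sup>2) (c - b(p) \<surd>(1 + p\<^sup>2)) / a(p)\<close>, whose right-hand side increases strictly with
  \<open>c\<close>.  A solution has to carry \<open>p\<close> from \<open>-h\<close> to \<open>h\<close> in exactly \<open>x\<close>-time \<open>2\<close>.

  Existence.  Since \<open>c\<close> may be sought among the nonnegative numbers, where \<open>p' > 0\<close>, it is enough to
  choose \<open>c\<close> so that the transit time is \<open>2\<close> and to invert.  In the inclination angle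
  \<open>\<theta> = arctan p\<close> the graph normal is the circle point of angle \<open>\<theta> + \<pi>/2\<close>; with \<open>f\<close> and \<open>g\<close> standing
  for \<open>A\<close> and \<open>-B\<close> at that angle, the transit time becomes
  \<open>T(c) = \<integral> f cos \<theta> / (c cos \<theta> + g) d\<theta>\<close> over \<open>[-\<alpha>, \<alpha>]\<close>, \<open>\<alpha> = arctan h\<close>.  The integrand is
  continuous up to \<open>\<theta> = \<plusminus>\<pi>/2\<close>, so \<open>h = \<infinity>\<close> is simply the case \<open>\<alpha> = \<pi>/2\<close>.  From
  \<open>f / g \<ge> a\<^sub>0 / (-b\<^sub>0)\<close> one gets \<open>T(0) \<ge> 2 (a\<^sub>0 / (-b\<^sub>0)) sin \<alpha> > 2\<close>, which is what the hypothesis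
  \<open>a\<^sub>0 h > -b\<^sub>0 \<surd>(1 + h\<^sup>2)\<close> says.  At \<open>c = a\<^sup>0 \<alpha>\<close> the integrand is below \<open>1/\<alpha>\<close>, so \<open>T < 2\<close> there.  The
  intermediate value theorem gives \<open>c\<close> together with both bounds
  (\<open>exists_speed_with_transit_time_two\<close>), and inverting \<open>x(\<theta>)\<close> gives \<open>\<phi>\<close>
  (\<open>exists_solution_of_transit_time_two\<close>).

  Uniqueness and monotonicity have to allow for competitors with \<open>c \<le> 0\<close>, for which the right-hand side
  may vanish somewhere.  But a solution that meets an equilibrium is constant
  (\<open>autonomous_ode_at_equilibrium_constant\<close>) and cannot join \<open>-h\<close> to \<open>h\<close>; so every solution has
  strictly increasing slope, running exactly through \<open>(-h, h)\<close>.  Now let two solutions with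
  \<open>h\<^sub>1 \<le> h\<^sub>2\<close> and \<open>c\<^sub>1 \<ge> c\<^sub>2\<close> be given, and let \<open>X\<^sub>2\<close> be the inverse of \<open>p\<^sub>2\<close>.  The first one runs at
  least as fast, so \<open>D(x) = X\<^sub>2(p\<^sub>1(x)) - x\<close> is nondecreasing; but \<open>X\<^sub>2\<close> takes values in \<open>(-1, 1)\<close>, so
  \<open>-1 - x < D(x) < 1 - x\<close>, and these barriers squeeze \<open>D\<close> to \<open>0\<close>.  Hence \<open>p\<^sub>1 = p\<^sub>2\<close>, \<open>h\<^sub>1 = h\<^sub>2\<close> and
  \<open>c\<^sub>1 = c\<^sub>2\<close> (\<open>solution_comparison\<close>).  With \<open>h\<^sub>1 = h\<^sub>2\<close> this is uniqueness; with \<open>h\<^sub>1 < h\<^sub>2\<close> it says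
  that \<open>c(h\<^sub>1) \<ge> c(h\<^sub>2)\<close> is impossible.
\<close>

section \<open>Equilibria of a scalar autonomous equation\<close>

text \<open>
  Gronwall's argument for the squared distance \<open>v = (p - q)\<^sup>2\<close>: the linear bound gives \<open>\<bar>v'\<bar> \<le> 2 L v\<close>, so
  \<open>v\<close> times \<open>exp (-2 L x)\<close> is nonincreasing and \<open>v\<close> times \<open>exp (2 L x)\<close> is nondecreasing.  Both products
  are nonnegative and vanish at \<open>x0\<close>; the first one settles the points to the right of \<open>x0\<close> and the second
  one the points to the left.
\<close>
lemma autonomous_ode_equilibrium_locally_constant:
  fixes p g :: "real \<Rightarrow> real"
  assumes ode: "\<And>x. \<bar>x - x0\<bar> < r \<Longrightarrow> (p has_real_derivative g (p x)) (at x)"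
    and gL: "\<And>x. \<bar>x - x0\<bar> < r \<Longrightarrow> \<bar>g (p x)\<bar> \<le> L * \<bar>p x - q\<bar>"
    and q: "p x0 = q" and x: "\<bar>x - x0\<bar> < r"
  shows "p x = q"
proof -
  have growth: "\<bar>(p y - q) * g (p y)\<bar> \<le> L * (p y - q)\<^sup>2" if "\<bar>y - x0\<bar> < r" for y
  proof -
    have "\<bar>(p y - q) * g (p y)\<bar> = \<bar>p y - q\<bar> * \<bar>g (p y)\<bar>" by (simp add: abs_mult)
    also have "\<dots> \<le> \<bar>p y - q\<bar> * (L * \<bar>p y - q\<bar>)"
      using gL[OF that] by (intro mult_left_mono) auto
    also have "\<dots> = L * (p y - q)\<^sup>2" by (simp add: power2_eq_square mult.left_commute)
    finally show ?thesis .
  qed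
  \<comment> \<open>The sign \<open>s = \<plusminus>1\<close> selects the exponential weight.\<close>
  define u where "u = (\<lambda>s y. (p y - q)\<^sup>2 * exp (s * (2 * L * y)))"
  have du: "(u s has_real_derivative
      (2 * ((p y - q) * g (p y)) + s * (2 * L * (p y - q)\<^sup>2)) * exp (s * (2 * L * y))) (at y)"
    if "\<bar>y - x0\<bar> < r" for y s
    unfolding u_def
    by (rule derivative_eq_intros ode[OF that] refl)+ (simp add: algebra_simps power2_eq_square)
  have u0: "u s x0 = 0" for s by (simp add: u_def q)
  have unn: "u s y \<ge> 0" for s y by (simp add: u_def)
  have "\<exists>s. u s x \<le> 0"
  proof (cases "x0 \<le> x")
    case True
    have "u (-1) x \<le> u (-1) x0"
    proof (rule DERIV_nonpos_imp_nonincreasing[OF True])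
      fix y assume "x0 \<le> y" "y \<le> x"
      then have y: "\<bar>y - x0\<bar> < r" using x by auto
      show "\<exists>D. (u (-1) has_real_derivative D) (at y) \<and> D \<le> 0"
        using du[OF y, of "-1"] growth[OF y] by (auto intro!: exI mult_nonpos_nonneg)
    qed
    then show ?thesis using u0 by metis
  next
    case False
    then have le: "x \<le> x0" by simp
    have "u 1 x \<le> u 1 x0"
    proof (rule DERIV_nonneg_imp_nondecreasing[OF le])
      fix y assume "x \<le> y" "y \<le> x0"
      then have y: "\<bar>y - x0\<bar> < r" using x by auto
      show "\<exists>D. (u 1 has_real_derivative D) (at y) \<and> 0 \<le> D"
        using du[OF y, of 1] growth[OF y] by (auto intro!: exI mult_nonneg_nonneg)
    qed
    then show ?thesis using u0 by metis
  qed
  then obtain s where "u s x = 0" using unn by (metis antisym)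
  then show ?thesis by (simp add: u_def)
qed

lemma differentiable_zero_imp_linear_bound:
  fixes g :: "real \<Rightarrow> real"
  assumes "g differentiable at q" "g q = 0"
  obtains L \<delta> where "0 < \<delta>" "\<And>y. \<bar>y - q\<bar> < \<delta> \<Longrightarrow> \<bar>g y\<bar> \<le> L * \<bar>y - q\<bar>"
proof -
  obtain D where "(g has_real_derivative D) (at q)"
    using assms(1) by (auto simp: real_differentiable_def)
  then have "((\<lambda>y. (g y - g q) / (y - q)) \<longlongrightarrow> D) (at q)"
    by (simp add: has_field_derivative_iff)
  then have "\<forall>\<^sub>F y in at q. dist ((g y - g q) / (y - q)) D < 1"
    by (rule tendstoD) simp
  then obtain \<delta> where \<delta>: "0 < \<delta>"
    "\<And>y. y \<noteq> q \<Longrightarrow> dist y q < \<delta> \<Longrightarrow> dist ((g y - g q) / (y - q)) D < 1"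
    by (auto simp: eventually_at)
  show thesis
  proof
    show "0 < \<delta>" by fact
    fix y assume y: "\<bar>y - q\<bar> < \<delta>"
    show "\<bar>g y\<bar> \<le> (\<bar>D\<bar> + 1) * \<bar>y - q\<bar>"
    proof (cases "y = q")
      case False
      then have "\<bar>g y / (y - q) - D\<bar> < 1"
        using \<delta>(2)[of y] y assms(2) by (simp add: dist_real_def)
      then have "\<bar>g y / (y - q)\<bar> \<le> \<bar>D\<bar> + 1" by linarith
      then show ?thesis using False by (simp add: abs_divide field_simps)
    qed (use assms in simp)
  qed
qed

text \<open>
  The set where \<open>p = q\<close> is closed in \<open>S\<close> by continuity and open by the local statement, hence all of the
  connected set \<open>S\<close>.  Differentiability at the equilibrium supplies the linear bound on \<open>g\<close>.
\<close>
lemma autonomous_ode_at_equilibrium_constant: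
  fixes p g :: "real \<Rightarrow> real"
  assumes S: "open S" "connected S"
    and ode: "\<And>x. x \<in> S \<Longrightarrow> (p has_real_derivative g (p x)) (at x)"
    and g: "g differentiable at q" "g q = 0"
    and x0: "x0 \<in> S" "p x0 = q" and x: "x \<in> S"
  shows "p x = q"
proof -
  obtain L \<delta> where L: "0 < \<delta>" "\<And>y. \<bar>y - q\<bar> < \<delta> \<Longrightarrow> \<bar>g y\<bar> \<le> L * \<bar>y - q\<bar>"
    using differentiable_zero_imp_linear_bound[OF g] by blast
  have cont: "continuous_on S p"
    using ode by (meson DERIV_isCont continuous_at_imp_continuous_on)
  let ?E = "{x \<in> S. p x = q}"
  have "open ?E"
    unfolding open_dist
  proof (intro ballI)
    fix z assume z: "z \<in> ?E"
    have "isCont p z" using ode z by (auto intro: DERIV_isCont)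
    then obtain r1 where r1: "0 < r1" "\<And>y. dist y z < r1 \<Longrightarrow> dist (p y) (p z) < \<delta>"
      using L(1) unfolding continuous_at_eps_delta by (auto simp: dist_commute)
    obtain r2 where r2: "0 < r2" "\<And>y. dist y z < r2 \<Longrightarrow> y \<in> S"
      using S z unfolding open_dist by auto
    have "p y = q \<and> y \<in> S" if y: "dist y z < min r1 r2" for y
    proof -
      have "p y = q"
      proof (rule autonomous_ode_equilibrium_locally_constant[of z "min r1 r2" p g L])
        fix y assume y: "\<bar>y - z\<bar> < min r1 r2"
        show "(p has_real_derivative g (p y)) (at y)"
          using ode r2(2) y by (auto simp: dist_real_def)
        show "\<bar>g (p y)\<bar> \<le> L * \<bar>p y - q\<bar>"
          using L(2) r1(2) y z by (auto simp: dist_real_def)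
      qed (use r1 r2 z y in \<open>auto simp: dist_real_def\<close>)
      then show ?thesis using r2 y by auto
    qed
    then show "\<exists>e>0. \<forall>y. dist y z < e \<longrightarrow> y \<in> ?E"
      using r1 r2 by (intro exI[of _ "min r1 r2"]) auto
  qed
  then have "openin (top_of_set S) ?E" using S by (auto simp: openin_open_eq)
  moreover have "closedin (top_of_set S) ?E"
    using continuous_closedin_preimage_constant[OF cont, of q] .
  ultimately have "?E = {} \<or> ?E = S" using S(2) unfolding connected_clopen by blast
  then show ?thesis using x0 x by blast
qed

section \<open>Solutions that cross the strip\<close>

text \<open>
  The boundary value problem for the slope alone.  It forgets how the speed \<open>g\<close> depends on \<open>c\<close>, \<open>a\<close> and
  \<open>b\<close>, and treats finite and infinite \<open>h\<close> together.
\<close>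
definition crosses :: "(real \<Rightarrow> real) \<Rightarrow> ereal \<Rightarrow> (real \<Rightarrow> real) \<Rightarrow> bool" where
  "crosses g h p \<longleftrightarrow>
     (\<forall>x\<in>{-1<..<1}. (p has_real_derivative g (p x)) (at x)) \<and>
     ((\<lambda>x. ereal (p x)) \<longlongrightarrow> - h) (at_right (-1)) \<and>
     ((\<lambda>x. ereal (p x)) \<longlongrightarrow> h) (at_left 1)"

lemma crosses_never_at_equilibrium:
  assumes "crosses g h p" "0 < h" "\<And>y. g differentiable at y" "x \<in> {-1<..<1}"
  shows "g (p x) \<noteq> 0"
proof
  assume 0: "g (p x) = 0"
  have const: "p z = p x" if "z \<in> {-1<..<1}" for z
    by (rule autonomous_ode_at_equilibrium_constant[of "{-1<..<1}" p g "p x" x])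
      (use assms that 0 in \<open>auto simp: crosses_def\<close>)
  have lim: "- h = ereal (p x)" "h = ereal (p x)"
  proof -
    have "\<forall>\<^sub>F z in at_right (-1). ereal (p z) = ereal (p x)"
      by (rule eventually_mono[OF eventually_at_right_real[of "-1" 1]]) (use const in auto)
    then show "- h = ereal (p x)"
      using tendsto_unique[OF trivial_limit_at_right_real _ tendsto_eventually] assms(1)
      unfolding crosses_def by blast
    have "\<forall>\<^sub>F z in at_left 1. ereal (p z) = ereal (p x)"
      by (rule eventually_mono[OF eventually_at_left_real[of "-1" 1]]) (use const in auto)
    then show "h = ereal (p x)"
      using tendsto_unique[OF trivial_limit_at_left_real _ tendsto_eventually] assms(1)
      unfolding crosses_def by blast
  qed
  show False using lim assms(2) by auto
qed

text \<open>
  Along the solution the speed is continuous and never zero, so it has one sign.  If it were negative, \<open>p\<close>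
  would decrease, and its end limits would give \<open>h \<le> p x \<le> - h\<close>.
\<close>
lemma crosses_speed_pos:
  assumes cr: "crosses g h p" and h: "0 < h" and g: "\<And>y. g differentiable at y"
    and x: "x \<in> {-1<..<1}"
  shows "0 < g (p x)"
proof (rule ccontr)
  assume "\<not> 0 < g (p x)"
  then have neg: "g (p x) < 0" using crosses_never_at_equilibrium[OF cr h g x] by simp
  have ode: "(p has_real_derivative g (p z)) (at z)" if "z \<in> {-1<..<1}" for z
    using cr that by (auto simp: crosses_def)
  have cont: "continuous_on {-1<..<1} (\<lambda>z. g (p z))"
  proof (rule continuous_at_imp_continuous_on, intro ballI)
    fix z :: real assume "z \<in> {-1<..<1}"
    then show "isCont (\<lambda>z. g (p z)) z"
      using isCont_o2[OF DERIV_isCont[OF ode] differentiable_imp_continuous_within[OF g]] by blast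
  qed
  have "connected ((\<lambda>z. g (p z)) ` {-1<..<1})"
    by (rule connected_continuous_image[OF cont]) simp
  then have allneg: "g (p z) < 0" if "z \<in> {-1<..<1}" for z
    using connectedD_interval[of "(\<lambda>z. g (p z)) ` {-1<..<1}" "g (p x)" "g (p z)" 0]
      neg x that crosses_never_at_equilibrium[OF cr h g]
    by (force simp: not_less)
  have dec: "p z \<le> p y" if "-1 < y" "y \<le> z" "z < 1" for y z
    by (rule DERIV_nonpos_imp_nonincreasing[OF \<open>y \<le> z\<close>])
      (use ode allneg that in \<open>force intro: less_imp_le\<close>)
  have "ereal (p x) \<le> - h"
  proof (rule tendsto_lowerbound)
    show "((\<lambda>x. ereal (p x)) \<longlongrightarrow> - h) (at_right (-1))" using cr by (simp add: crosses_def)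
    show "\<forall>\<^sub>F z in at_right (-1). ereal (p x) \<le> ereal (p z)"
      using eventually_at_right_real[of "-1" x] x dec by (auto elim!: eventually_mono)
  qed simp
  moreover have "h \<le> ereal (p x)"
  proof (rule tendsto_upperbound)
    show "((\<lambda>x. ereal (p x)) \<longlongrightarrow> h) (at_left 1)" using cr by (simp add: crosses_def)
    show "\<forall>\<^sub>F z in at_left 1. ereal (p z) \<le> ereal (p x)"
      using eventually_at_left_real[of x 1] x dec by (auto elim!: eventually_mono)
  qed simp
  ultimately have "h \<le> - h" by (rule order_trans[rotated])
  then show False using h by (cases h) auto
qed

lemma crosses_strict_mono:
  assumes "crosses g h p" "0 < h" "\<And>y. g differentiable at y"
  shows "strict_mono_on {-1<..<1} p"
proof (rule strict_mono_onI)
  fix y z :: real assume "y \<in> {-1<..<1}" "z \<in> {-1<..<1}" "y < z"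
  then show "p y < p z"
    using crosses_speed_pos[OF assms] assms(1)
    by (intro DERIV_pos_imp_increasing[OF \<open>y < z\<close>] exI conjI) (auto simp: crosses_def)
qed

text \<open>
  The range does not depend on the speed.  This is what makes two crossings comparable: every slope taken by
  the one with the smaller \<open>h\<close> is also taken by the other.
\<close>
lemma crosses_image:
  assumes cr: "crosses g h p" and h: "0 < h" and g: "\<And>y. g differentiable at y"
  shows "p ` {-1<..<1} = {y. - h < ereal y \<and> ereal y < h}"
proof (intro equalityI subsetI)
  note mono = strict_mono_onD[OF crosses_strict_mono[OF assms]]
  fix y assume "y \<in> p ` {-1<..<1}"
  then obtain x where x: "-1 < x" "x < 1" "y = p x" by auto
  obtain x1 where x1: "-1 < x1" "x1 < x" using dense[OF x(1)] by auto
  obtain x2 where x2: "x < x2" "x2 < 1" using dense[OF x(2)] by auto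
  note x12 = x1 x2
  have "- h \<le> ereal (p x1)"
  proof (rule tendsto_upperbound)
    show "((\<lambda>x. ereal (p x)) \<longlongrightarrow> - h) (at_right (-1))" using cr by (simp add: crosses_def)
    show "\<forall>\<^sub>F z in at_right (-1). ereal (p z) \<le> ereal (p x1)"
      using eventually_at_right_real[of "-1" x1] x12 mono
      by (auto elim!: eventually_mono intro!: less_imp_le)
  qed simp
  moreover have "ereal (p x2) \<le> h"
  proof (rule tendsto_lowerbound)
    show "((\<lambda>x. ereal (p x)) \<longlongrightarrow> h) (at_left 1)" using cr by (simp add: crosses_def)
    show "\<forall>\<^sub>F z in at_left 1. ereal (p x2) \<le> ereal (p z)"
      using eventually_at_left_real[of x2 1] x12 mono
      by (auto elim!: eventually_mono intro!: less_imp_le)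
  qed simp
  moreover have "ereal (p x1) < ereal y" "ereal y < ereal (p x2)" using mono x x12 by auto
  ultimately have "- h < ereal y" "ereal y < h"
    by (blast intro: le_less_trans less_le_trans)+
  then show "y \<in> {y. - h < ereal y \<and> ereal y < h}" by simp
next
  fix y assume "y \<in> {y. - h < ereal y \<and> ereal y < h}"
  then have y: "- h < ereal y" "ereal y < h" by auto
  have "\<forall>\<^sub>F z in at_right (-1). ereal (p z) < ereal y"
    using cr y(1) by (intro order_tendstoD[where y = "- h"]) (auto simp: crosses_def)
  moreover have "\<forall>\<^sub>F z in at_right (-1). z \<in> {-1<..<(1::real)}"
    by (rule eventually_at_right_real) simp
  ultimately have "\<exists>z. ereal (p z) < ereal y \<and> z \<in> {-1<..<(1::real)}"
    by (rule eventually_happens'[OF _ eventually_conj, rotated]) simp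
  then obtain x1 where x1: "p x1 < y" "x1 \<in> {-1<..<1}" by auto
  have "\<forall>\<^sub>F z in at_left 1. ereal y < ereal (p z)"
    using cr y(2) by (intro order_tendstoD[where y = h]) (auto simp: crosses_def)
  moreover have "\<forall>\<^sub>F z in at_left 1. z \<in> {-1<..<(1::real)}"
    by (rule eventually_at_left_real) simp
  ultimately have "\<exists>z. ereal y < ereal (p z) \<and> z \<in> {-1<..<(1::real)}"
    by (rule eventually_happens'[OF _ eventually_conj, rotated]) simp
  then obtain x2 where x2: "y < p x2" "x2 \<in> {-1<..<1}" by auto
  have "continuous_on {-1<..<1} p"
    using cr by (auto simp: crosses_def intro!: continuous_at_imp_continuous_on DERIV_isCont)
  then have "connected (p ` {-1<..<1})"
    by (rule connected_continuous_image) simp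
  from connectedD_interval[OF this, of "p x1" "p x2" y]
  show "y \<in> p ` {-1<..<1}" using x1 x2 by auto
qed

text \<open>
  A monotone function tends at the ends of an interval to the infimum and supremum of its range, so the
  boundary conditions can be read off from the range, for finite and infinite \<open>h\<close> alike.
\<close>
lemma strict_mono_onto_imp_crosses:
  assumes ode: "\<And>x. x \<in> {-1<..<1} \<Longrightarrow> (p has_real_derivative g (p x)) (at x)"
    and mono: "strict_mono_on {-1<..<1} p"
    and im: "p ` {-1<..<1} = {y. - h < ereal y \<and> ereal y < h}"
  shows "crosses g h p"
  unfolding crosses_def
proof (intro conjI ballI ode)
  have bd: "- h < ereal (p x)" "ereal (p x) < h" if "-1 < x" "x < 1" for x
    using im that by auto
  have nt: "- h < h" using less_trans[OF bd[of 0]] by simp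
  show "((\<lambda>x. ereal (p x)) \<longlongrightarrow> - h) (at_right (-1))"
  proof (rule order_tendstoI)
    fix M assume "M < - h"
    then have "M < ereal (p x)" if "x \<in> {-1<..<1}" for x
      using less_trans[OF _ bd(1)] that by auto
    then show "\<forall>\<^sub>F x in at_right (-1). M < ereal (p x)"
      by (intro eventually_mono[OF eventually_at_right_real[of "-1" 1]]) auto
  next
    fix M assume "- h < M"
    then obtain y where y: "- h < ereal y" "ereal y < min M h" using ereal_dense2[of "- h" "min M h"] nt
      by auto
    then have "y \<in> p ` {-1<..<1}" using im by simp
    then obtain x0 where x0: "y = p x0" "x0 \<in> {-1<..<1}" by auto
    have "ereal (p x) < M" if "x \<in> {-1<..<x0}" for x
    proof -
      have "p x < y" using strict_mono_onD[OF mono, of x x0] x0 that by auto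
      then have "ereal (p x) < ereal y" by simp
      also have "\<dots> < M" using y by simp
      finally show ?thesis .
    qed
    then show "\<forall>\<^sub>F x in at_right (-1). ereal (p x) < M"
      using eventually_at_right_real[of "-1" x0] x0 by (auto elim!: eventually_mono)
  qed
  show "((\<lambda>x. ereal (p x)) \<longlongrightarrow> h) (at_left 1)"
  proof (rule order_tendstoI)
    fix M assume "h < M"
    then have "ereal (p x) < M" if "x \<in> {-1<..<1}" for x
      using less_trans[OF bd(2)] that by auto
    then show "\<forall>\<^sub>F x in at_left 1. ereal (p x) < M"
      by (intro eventually_mono[OF eventually_at_left_real[of "-1" 1]]) auto
  next
    fix M assume "M < h"
    then obtain y where y: "ereal y < h" "max M (- h) < ereal y" using ereal_dense2[of "max M (- h)" h] nt
      by auto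
    then have "y \<in> p ` {-1<..<1}" using im by simp
    then obtain x0 where x0: "y = p x0" "x0 \<in> {-1<..<1}" by auto
    have "M < ereal (p x)" if "x \<in> {x0<..<1}" for x
    proof -
      have "y < p x" using strict_mono_onD[OF mono, of x0 x] x0 that by auto
      then have "ereal y < ereal (p x)" by simp
      moreover have "M < ereal y" using y(2) by simp
      ultimately show ?thesis by (rule less_trans[rotated])
    qed
    then show "\<forall>\<^sub>F x in at_left 1. M < ereal (p x)"
      using eventually_at_left_real[of x0 1] x0 by (auto elim!: eventually_mono)
  qed
qed

section \<open>Comparison of two crossings\<close>

text \<open>
  A positive value \<open>D x\<close> persists to the right and collides with the upper barrier at the point
  \<open>1 - D x\<close>, where the barrier has height \<open>D x\<close>; a negative value persists to the left and collides with
  the lower barrier at \<open>-1 - D x\<close>.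
\<close>
lemma nondecreasing_between_barriers_zero:
  fixes D :: "real \<Rightarrow> real"
  assumes mono: "\<And>x y. -1 < x \<Longrightarrow> x \<le> y \<Longrightarrow> y < 1 \<Longrightarrow> D x \<le> D y"
    and bd: "\<And>x. x \<in> {-1<..<1} \<Longrightarrow> -1 - x < D x \<and> D x < 1 - x"
    and x: "x \<in> {-1<..<1}"
  shows "D x = 0"
proof (rule linorder_cases[of "D x" 0])
  assume "D x < 0"
  then show ?thesis using mono[of "-1 - D x" x] bd[of x] bd[of "-1 - D x"] x by auto
next
  assume "0 < D x"
  then show ?thesis using mono[of x "1 - D x"] bd[of x] bd[of "1 - D x"] x by auto
qed

text \<open>
  \<open>D y\<close> below is the difference between the places at which the second and the first crossing have the
  slope \<open>p1 y\<close>.  Its derivative is \<open>g1 / g2 - 1 \<ge> 0\<close> at that slope.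
\<close>
lemma crossing_comparison:
  assumes cr1: "crosses g1 h1 p1" and cr2: "crosses g2 h2 p2"
    and h: "0 < h1" "h1 \<le> h2"
    and g: "\<And>y. g1 differentiable at y" "\<And>y. g2 differentiable at y"
    and le: "\<And>y. g2 y \<le> g1 y"
    and x: "x \<in> {-1<..<1}"
  shows "p1 x = p2 x"
proof -
  let ?I = "{-1<..<1::real}"
  have h2: "0 < h2" using h by (rule less_le_trans)
  have inj: "inj_on p2 ?I"
    using crosses_strict_mono[OF cr2 h2 g(2)] by (rule strict_mono_on_imp_inj_on)
  define X where "X = the_inv_into ?I p2"
  have X: "X (p2 z) = z" if "z \<in> ?I" for z
    using the_inv_into_f_f[OF inj that] by (simp add: X_def)
  have ode2: "(p2 has_real_derivative g2 (p2 z)) (at z)" if "z \<in> ?I" for z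
    using cr2 that by (auto simp: crosses_def)
  have cont2: "continuous_on ?I p2"
    using ode2 by (meson DERIV_isCont continuous_at_imp_continuous_on)
  have hit: "\<exists>z\<in>?I. p1 y = p2 z" if "y \<in> ?I" for y
  proof -
    have "- h2 \<le> - h1" using h by simp
    moreover have "- h1 < ereal (p1 y)" "ereal (p1 y) < h1"
      using crosses_image[OF cr1 h(1) g(1)] that by auto
    ultimately have "- h2 < ereal (p1 y)" "ereal (p1 y) < h2"
      using h(2) by (blast intro: le_less_trans less_le_trans)+
    then have "p1 y \<in> p2 ` ?I" using crosses_image[OF cr2 h2 g(2)] by auto
    then show ?thesis by auto
  qed
  have XI: "X (p1 y) \<in> ?I" if "y \<in> ?I" for y
    using hit[OF that] X by auto
  define D where "D = (\<lambda>y. X (p1 y) - y)"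
  have dD: "\<exists>d. (D has_real_derivative d) (at y) \<and> 0 \<le> d" if y: "y \<in> ?I" for y
  proof -
    obtain z where z: "z \<in> ?I" "p1 y = p2 z" using hit[OF y] by auto
    have pos: "0 < g2 (p2 z)" using crosses_speed_pos[OF cr2 h2 g(2) z(1)] .
    have "(X has_real_derivative inverse (g2 (p2 z))) (at (p2 z))"
      by (rule has_field_derivative_inverse_strong[OF ode2 _ _ _ cont2 X])
        (use z pos in auto)
    then have "(X has_real_derivative inverse (g2 (p1 y))) (at (p1 y))" using z by simp
    moreover have "(p1 has_real_derivative g1 (p1 y)) (at y)"
      using cr1 y by (auto simp: crosses_def)
    ultimately have "((\<lambda>y. X (p1 y)) has_real_derivative inverse (g2 (p1 y)) * g1 (p1 y)) (at y)"
      by (rule DERIV_chain2)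
    then have "(D has_real_derivative inverse (g2 (p1 y)) * g1 (p1 y) - 1) (at y)"
      unfolding D_def by (rule DERIV_diff) (rule DERIV_ident)
    moreover have "0 \<le> inverse (g2 (p1 y)) * g1 (p1 y) - 1"
      using le[of "p1 y"] pos z by (simp add: field_simps)
    ultimately show ?thesis by blast
  qed
  have "D x = 0"
  proof (rule nondecreasing_between_barriers_zero[OF _ _ x])
    fix y z :: real assume "-1 < y" "y \<le> z" "z < 1"
    show "D y \<le> D z"
      by (rule DERIV_nonneg_imp_nondecreasing[OF \<open>y \<le> z\<close>], rule dD)
        (use \<open>-1 < y\<close> \<open>z < 1\<close> in auto)
  next
    fix y assume "y \<in> ?I"
    then show "-1 - y < D y \<and> D y < 1 - y" using XI by (auto simp: D_def)
  qed
  then have "X (p1 x) = x" by (simp add: D_def)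
  then show ?thesis using hit[OF x] X by auto
qed

section \<open>The slope equation\<close>

text \<open>The equation of the problem solved for \<open>\<phi>''\<close>, as a function of the slope \<open>y = \<phi>'\<close>.\<close>
definition slope_speed :: "(real \<Rightarrow> real) \<Rightarrow> (real \<Rightarrow> real) \<Rightarrow> real \<Rightarrow> real \<Rightarrow> real" where
  "slope_speed a b c y = (1 + y\<^sup>2) * (c - b y * sqrt (1 + y\<^sup>2)) / a y"

lemma slope_speed_differentiable:
  assumes "\<And>y. a differentiable at y" "\<And>y. b differentiable at y" "\<And>y. 0 < a y"
  shows "slope_speed a b c differentiable at y"
proof -
  have pos: "0 < 1 + y\<^sup>2" by (simp add: add_pos_nonneg)
  have "sqrt differentiable at (1 + y\<^sup>2)"
    using DERIV_real_sqrt[OF pos] real_differentiable_def by blast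
  moreover have "(\<lambda>y. 1 + y\<^sup>2) differentiable at y" by (intro derivative_intros)
  ultimately have "(\<lambda>y. sqrt (1 + y\<^sup>2)) differentiable at y"
    by (rule differentiable_compose)
  moreover have "a y \<noteq> 0" using assms(3)[of y] by simp
  ultimately show ?thesis
    unfolding slope_speed_def[abs_def] using assms(1,2)
    by (intro differentiable_divide differentiable_mult differentiable_diff differentiable_add
        differentiable_const differentiable_power differentiable_ident) auto
qed

lemma solves_P_iff_crosses:
  assumes "\<And>y. 0 < a y"
  shows "solves_P a b h c \<phi> \<longleftrightarrow>
    (\<forall>x\<in>{-1<..<1}. \<phi> differentiable at x) \<and> crosses (slope_speed a b c) h (deriv \<phi>)"
proof -
  have eq: "c = a y * (d / (1 + y\<^sup>2)) + b y * sqrt (1 + y\<^sup>2) \<longleftrightarrow> d = slope_speed a b c y"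
    for d y :: real
  proof -
    have "0 < 1 + y\<^sup>2" by (simp add: add_pos_nonneg)
    then show ?thesis using assms[of y] unfolding slope_speed_def
      by (auto simp: divide_simps) (auto simp: algebra_simps)
  qed
  have "(deriv \<phi> differentiable at x \<and> deriv (deriv \<phi>) x = d) \<longleftrightarrow>
      (deriv \<phi> has_real_derivative d) (at x)" for x d
    by (metis DERIV_imp_deriv DERIV_deriv_iff_real_differentiable real_differentiable_def)
  then show ?thesis
    unfolding solves_P_def crosses_def eq by blast
qed

text \<open>
  The speed increases with \<open>c\<close>, so the crossings are comparable and their slopes agree.  Then \<open>h\<close> is their
  common limit at \<open>1\<close>, and since the speed is strictly increasing in \<open>c\<close>, the common value of \<open>\<phi>''\<close> at one
  point determines \<open>c\<close>.
\<close>
lemma solution_comparison: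
  assumes s1: "solves_P a b h1 c1 \<phi>1" and s2: "solves_P a b h2 c2 \<phi>2"
    and h: "0 < h1" "h1 \<le> h2" and c: "c2 \<le> c1"
    and ab: "\<And>y. a differentiable at y" "\<And>y. b differentiable at y" "\<And>y. 0 < a y"
  shows "h1 = h2 \<and> c1 = c2 \<and> equal_up_to_shift \<phi>1 \<phi>2"
proof -
  let ?g = "slope_speed a b"
  have cr1: "crosses (?g c1) h1 (deriv \<phi>1)" and cr2: "crosses (?g c2) h2 (deriv \<phi>2)"
    and d: "\<And>x. x \<in> {-1<..<1} \<Longrightarrow> \<phi>1 differentiable at x"
      "\<And>x. x \<in> {-1<..<1} \<Longrightarrow> \<phi>2 differentiable at x"
    using s1 s2 ab(3) by (auto simp: solves_P_iff_crosses)
  note diff = slope_speed_differentiable[OF ab]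
  have le: "?g c2 y \<le> ?g c1 y" for y
    unfolding slope_speed_def using ab(3)[of y] c
    by (intro divide_right_mono mult_left_mono) auto
  have same: "deriv \<phi>1 x = deriv \<phi>2 x" if "x \<in> {-1<..<1}" for x
    using crossing_comparison[OF cr1 cr2 h diff diff le that] .
  have "h1 = h2"
  proof (rule tendsto_unique)
    show "((\<lambda>x. ereal (deriv \<phi>2 x)) \<longlongrightarrow> h2) (at_left 1)" using cr2 by (simp add: crosses_def)
    have "((\<lambda>x. ereal (deriv \<phi>1 x)) \<longlongrightarrow> h1) (at_left 1)" using cr1 by (simp add: crosses_def)
    then show "((\<lambda>x. ereal (deriv \<phi>2 x)) \<longlongrightarrow> h1) (at_left 1)"
      using eventually_at_left_real[of "-1" 1] same
      by (auto elim!: Lim_transform_eventually eventually_mono)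
  qed simp
  moreover have "c1 = c2"
  proof -
    let ?y = "deriv \<phi>1 0"
    have "(deriv \<phi>1 has_real_derivative ?g c1 ?y) (at 0)"
      using cr1 by (auto simp: crosses_def)
    moreover have "(deriv \<phi>2 has_real_derivative ?g c2 ?y) (at 0)"
      using cr2 same[of 0] by (auto simp: crosses_def)
    then have "(deriv \<phi>1 has_real_derivative ?g c2 ?y) (at 0)"
      by (rule has_field_derivative_transform_within_open[of _ _ _ "{-1<..<1}"])
        (use same in auto)
    ultimately have "?g c1 ?y = ?g c2 ?y" by (rule DERIV_unique)
    moreover have "1 + ?y\<^sup>2 \<noteq> 0" "a ?y \<noteq> 0"
      using ab(3)[of ?y] by (auto simp: add_nonneg_eq_0_iff)
    ultimately show ?thesis by (auto simp: slope_speed_def)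
  qed
  moreover have "equal_up_to_shift \<phi>1 \<phi>2"
  proof -
    have "\<exists>k. \<forall>x\<in>{-1<..<1}. \<phi>1 x - \<phi>2 x = k"
    proof (rule has_field_derivative_zero_constant)
      fix x :: real assume x: "x \<in> {-1<..<1}"
      have "((\<lambda>x. \<phi>1 x - \<phi>2 x) has_real_derivative deriv \<phi>1 x - deriv \<phi>2 x) (at x)"
        using d x by (intro DERIV_diff) (auto simp: DERIV_deriv_iff_real_differentiable)
      then show "((\<lambda>x. \<phi>1 x - \<phi>2 x) has_real_derivative 0) (at x within {-1<..<1})"
        using same[OF x] by (simp add: has_field_derivative_at_within)
    qed simp
    then show ?thesis unfolding equal_up_to_shift_def by (metis add.commute diff_add_cancel)
  qed
  ultimately show ?thesis by blast
qed

section \<open>Existence through the inclination angle\<close>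

text \<open>
  This is \<open>dx/d\<theta>\<close> along a solution, where \<open>\<theta> = arctan p\<close> is the inclination angle and \<open>f\<close>, \<open>g\<close> are
  \<open>a\<close>, \<open>-b\<close> as functions of \<open>\<theta>\<close>: since \<open>\<surd>(1 + p\<^sup>2) = 1 / cos \<theta>\<close>, the slope equation reads
  \<open>d\<theta>/dx = (c + g / cos \<theta>) / f\<close>.  Multiplying through by \<open>cos \<theta>\<close> makes the density continuous at the
  vertical directions.
\<close>
definition transit_density ::
  "(real \<Rightarrow> real) \<Rightarrow> (real \<Rightarrow> real) \<Rightarrow> real \<Rightarrow> real \<Rightarrow> real" where
  "transit_density f g c t = f t * cos t / (c * cos t + g t)"

lemma inclination_denominator_pos:
  fixes g :: "real \<Rightarrow> real"
  assumes "0 \<le> c" "0 < g t" "\<bar>t\<bar> \<le> pi / 2"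
  shows "0 < c * cos t + g t"
proof -
  have "0 \<le> cos t" using assms(3) by (intro cos_ge_zero) (auto simp: abs_le_iff)
  then show ?thesis using assms by (intro add_nonneg_pos mult_nonneg_nonneg)
qed

text \<open>
  The transit time \<open>T\<close> is continuous in \<open>c\<close>.  At \<open>c = 0\<close> the density is at least \<open>(m / n) cos t\<close>, whose
  integral \<open>2 (m / n) sin \<alpha>\<close> exceeds \<open>2\<close>; at \<open>c = M \<alpha>\<close> it is below \<open>1 / \<alpha>\<close>, whose integral is \<open>2\<close>.
  As both inequalities are strict, so are the bounds on \<open>c\<close>.  The bounds on \<open>f\<close> and \<open>g\<close> concern
  \<open>\<bar>t\<bar> < \<pi>/2\<close> because these are the inclinations of graphs; at \<open>t = \<plusminus>\<pi>/2\<close> the density vanishes.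
\<close>
lemma exists_speed_with_transit_time_two:
  fixes f g :: "real \<Rightarrow> real"
  assumes cont: "continuous_on UNIV f" "continuous_on UNIV g"
    and pos: "\<And>t. 0 < f t" "\<And>t. 0 < g t"
    and \<alpha>: "0 < \<alpha>" "\<alpha> \<le> pi / 2"
    and bounds: "\<And>t. \<bar>t\<bar> < pi / 2 \<Longrightarrow> m \<le> f t \<and> f t \<le> M \<and> g t \<le> n"
    and key: "n < m * sin \<alpha>"
  shows "\<exists>c. 0 < c \<and> c < M * \<alpha> \<and> integral {-\<alpha>..\<alpha>} (transit_density f g c) = 2"
proof -
  define T where "T = (\<lambda>c. integral {-\<alpha>..\<alpha>} (transit_density f g c))"
  have M: "0 < M" and n: "0 < n"
    using bounds[of 0] pos[of 0] by auto
  have MA: "0 < M * \<alpha>" using M \<alpha> by simp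
  have contfg: "continuous_on (S::(real\<times>real) set) (\<lambda>z. f (snd z))"
    "continuous_on S (\<lambda>z. g (snd z))" for S
    by (rule continuous_on_compose2[OF cont(1)] continuous_on_compose2[OF cont(2)];
        intro continuous_intros subset_UNIV)+
  have denom: "0 < c * cos t + g t" if "0 \<le> c" "\<bar>t\<bar> \<le> \<alpha>" for c t
    using inclination_denominator_pos[of c g t] pos(2)[of t] that \<alpha> by auto
  have "continuous_on ({0..M*\<alpha>} \<times> cbox (-\<alpha>) \<alpha>) (\<lambda>(c, t). transit_density f g c t)"
    unfolding transit_density_def case_prod_unfold using denom
    by (intro continuous_intros contfg) (force simp: less_le)
  then have contT: "continuous_on {0..M*\<alpha>} T"
    unfolding T_def box_real(2)[symmetric] by (rule integral_continuous_on_param)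
  have contK: "continuous_on {-\<alpha>..\<alpha>} (transit_density f g c)" if "0 \<le> c" for c
    unfolding transit_density_def using denom[OF that] cont
    by (intro continuous_intros) (auto simp: abs_le_iff less_le intro: continuous_on_subset)
  have ne: "{-\<alpha><..<\<alpha>} \<noteq> {}" using \<alpha> by auto
  have high: "T (M * \<alpha>) < 2"
  proof -
    have "T (M * \<alpha>) < integral {-\<alpha>..\<alpha>} (\<lambda>t. 1 / \<alpha>)"
      unfolding T_def
    proof (rule integral_less_real[OF contK continuous_on_const ne])
      fix t assume t: "t \<in> {-\<alpha><..<\<alpha>}"
      then have t': "\<bar>t\<bar> < pi / 2" using \<alpha> by auto
      then have "0 < cos t" using cos_gt_zero_pi[of t] by auto
      then have "\<alpha> * (f t * cos t) \<le> \<alpha> * (M * cos t)"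
        using bounds[OF t'] \<alpha> by (intro mult_left_mono mult_right_mono) auto
      also have "\<dots> < M * \<alpha> * cos t + g t" using pos(2)[of t] by (simp add: mult_ac)
      finally have "\<alpha> * (f t * cos t) < M * \<alpha> * cos t + g t" .
      moreover have "0 < M * \<alpha> * cos t + g t" using denom[of "M * \<alpha>" t] MA t by auto
      ultimately show "transit_density f g (M * \<alpha>) t < 1 / \<alpha>"
        using \<alpha> by (simp add: transit_density_def field_simps)
    qed (use MA in simp)
    also have "\<dots> = 2" using \<alpha> by simp
    finally show ?thesis .
  qed
  have low: "2 < T 0"
  proof -
    have "((\<lambda>t. m / n * cos t) has_integral (m / n * sin \<alpha> - m / n * sin (-\<alpha>))) {-\<alpha>..\<alpha>}"
      using \<alpha> n by (intro fundamental_theorem_of_calculus)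
        (auto simp: has_real_derivative_iff_has_vector_derivative[symmetric]
          intro!: derivative_eq_intros)
    from integral_unique[OF this]
    have i: "integral {-\<alpha>..\<alpha>} (\<lambda>t. m / n * cos t) = 2 * (m * sin \<alpha> / n)" by simp
    have "2 < 2 * (m * sin \<alpha> / n)" using key n by (simp add: field_simps)
    also have "\<dots> \<le> T 0"
      unfolding T_def i[symmetric]
    proof (rule integral_le)
      show "(\<lambda>t. m / n * cos t) integrable_on {-\<alpha>..\<alpha>}"
        by (intro integrable_continuous_real continuous_intros)
      show "transit_density f g 0 integrable_on {-\<alpha>..\<alpha>}"
        by (intro integrable_continuous_real contK) simp
      fix t assume t: "t \<in> {-\<alpha>..\<alpha>}"
      show "m / n * cos t \<le> transit_density f g 0 t"
      proof (cases "\<bar>t\<bar> < pi / 2")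
        case True
        then have "0 < cos t" using cos_gt_zero_pi[of t] by auto
        moreover have "m / n \<le> f t / g t"
          using bounds[OF True] pos by (intro frac_le) (auto simp: less_imp_le)
        ultimately have "m / n * cos t \<le> f t / g t * cos t" by (intro mult_right_mono) auto
        then show ?thesis by (simp add: transit_density_def)
      next
        case False
        then have "t = pi / 2 \<or> t = - (pi / 2)" using t \<alpha> by auto
        then have "cos t = 0" using cos_pi_half cos_minus[of "pi / 2"] by metis
        then show ?thesis by (simp add: transit_density_def)
      qed
    qed
    finally show ?thesis .
  qed
  obtain c where c: "0 \<le> c" "c \<le> M * \<alpha>" "T c = 2"
    using IVT2'[of T "M * \<alpha>" 2 0] low high MA contT by auto
  moreover have "c \<noteq> 0" "c \<noteq> M * \<alpha>" using c(3) low high by auto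
  ultimately show ?thesis unfolding T_def by (intro exI[of _ c]) auto
qed

text \<open>
  \<open>U\<close> gives the position \<open>x\<close> at which the inclination is \<open>t\<close>; the transit time \<open>2\<close> makes it a bijection of
  \<open>(-\<alpha>, \<alpha>)\<close> onto \<open>(-1, 1)\<close>, and its inverse \<open>\<Theta>\<close> yields the slope \<open>tan \<circ> \<Theta>\<close>.  The height \<open>\<phi>\<close> is
  obtained as a function of the angle too: \<open>d\<phi> = tan \<theta> dx = f sin \<theta> / (c cos \<theta> + g) d\<theta>\<close> is integrable up to
  the vertical, whereas the slope is unbounded there.  The hypothesis on \<open>h\<close> covers \<open>\<alpha> = arctan h\<close> for finite
  \<open>h\<close> and \<open>\<alpha> = \<pi>/2\<close> for \<open>h = \<infinity>\<close>.
\<close>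
lemma exists_solution_of_transit_time_two:
  fixes f g :: "real \<Rightarrow> real"
  assumes cont: "continuous_on UNIV f" "continuous_on UNIV g"
    and pos: "\<And>t. 0 < f t" "\<And>t. 0 < g t"
    and \<alpha>: "0 < \<alpha>" "\<alpha> \<le> pi / 2"
    and h: "\<And>y. (- h < ereal y \<and> ereal y < h) \<longleftrightarrow> \<bar>arctan y\<bar> < \<alpha>"
    and c: "0 \<le> c" "integral {-\<alpha>..\<alpha>} (transit_density f g c) = 2"
    and a: "\<And>y. a y = f (arctan y)" and b: "\<And>y. b y = - g (arctan y)"
  shows "\<exists>\<phi>. solves_P a b h c \<phi>"
proof -
  let ?J = "{-\<alpha>..\<alpha>}" and ?I = "{-1<..<1::real}" and ?S = "{-\<alpha><..<\<alpha>}"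
  define K where "K = transit_density f g c"
  define W where "W = (\<lambda>t. f t * sin t / (c * cos t + g t))"
  have denom: "0 < c * cos t + g t" if "t \<in> ?J" for t
    using inclination_denominator_pos[of c g t] pos(2)[of t] c(1) that \<alpha> by auto
  have contK: "continuous_on ?J K" and contW: "continuous_on ?J W"
    unfolding K_def W_def transit_density_def using denom cont
    by (intro continuous_intros; force simp: less_le intro: continuous_on_subset)+
  have cos: "0 < cos t" if "t \<in> ?S" for t
    using cos_gt_zero_pi[of t] that \<alpha> by auto
  have Kpos: "0 < K t" if "t \<in> ?S" for t
    unfolding K_def transit_density_def using cos[OF that] pos(1)[of t] denom[of t] that by auto
  define U where "U = (\<lambda>t. integral {-\<alpha>..t} K - 1)"
  define V where "V = (\<lambda>t. integral {-\<alpha>..t} W)"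
  have dU': "(U has_real_derivative K t) (at t within ?J)" if "t \<in> ?J" for t
    unfolding U_def using DERIV_diff[OF integral_has_real_derivative[OF contK that] DERIV_const]
    by simp
  have at: "at t within ?J = at t" if "t \<in> ?S" for t
    using that by (intro at_within_Icc_at) auto
  have dU: "(U has_real_derivative K t) (at t)" if "t \<in> ?S" for t
    using dU'[of t] at[OF that] that by auto
  have dV: "(V has_real_derivative W t) (at t)" if "t \<in> ?S" for t
    using integral_has_real_derivative[OF contW, of t] at[OF that] that unfolding V_def by auto
  have contU: "continuous_on ?J U"
    using dU' by (meson DERIV_continuous continuous_on_eq_continuous_within)
  have U_ends: "U (-\<alpha>) = -1" "U \<alpha> = 1"
    using c(2) by (auto simp: U_def K_def)
  have Umono: "U s < U t" if "s \<in> ?J" "t \<in> ?J" "s < t" for s t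
  proof (rule DERIV_pos_imp_increasing_open[OF that(3)])
    fix x assume "s < x" "x < t"
    then have "x \<in> ?S" using that by auto
    then show "\<exists>y. (U has_real_derivative y) (at x) \<and> 0 < y" using dU Kpos by blast
  qed (use that in \<open>auto intro: continuous_on_subset[OF contU]\<close>)
  have UI: "U t \<in> ?I" if "t \<in> ?S" for t
    using Umono[of "-\<alpha>" t] Umono[of t \<alpha>] that U_ends by auto
  have injU: "inj_on U ?S"
  proof (rule inj_onI)
    fix s t assume "s \<in> ?S" "t \<in> ?S" "U s = U t"
    then show "s = t" using Umono[of s t] Umono[of t s] by (cases s t rule: linorder_cases) auto
  qed
  define \<Theta> where "\<Theta> = the_inv_into ?S U"
  have \<Theta>U: "\<Theta> (U t) = t" if "t \<in> ?S" for t
    unfolding \<Theta>_def by (rule the_inv_into_f_f[OF injU that])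
  have onto: "\<exists>t\<in>?S. x = U t" if "x \<in> ?I" for x
  proof -
    have le: "U (-\<alpha>) \<le> x" "x \<le> U \<alpha>" "-\<alpha> \<le> \<alpha>" using that U_ends \<alpha> by auto
    obtain t where t: "-\<alpha> \<le> t" "t \<le> \<alpha>" "U t = x"
      using IVT'[OF le contU] by blast
    moreover have "t \<noteq> -\<alpha>" "t \<noteq> \<alpha>" using t(3) U_ends that by auto
    ultimately show ?thesis by (intro bexI[of _ t]) auto
  qed
  have d\<Theta>: "(\<Theta> has_real_derivative inverse (K t)) (at (U t))" if "t \<in> ?S" for t
  proof (rule has_field_derivative_inverse_strong[OF dU[OF that] _ _ that _ \<Theta>U])
    show "continuous_on ?S U" by (rule continuous_on_subset[OF contU]) auto
    show "K t \<noteq> 0" using Kpos[OF that] by simp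
  qed auto
  define \<phi> where "\<phi> = (\<lambda>x. V (\<Theta> x))"
  have d\<phi>: "(\<phi> has_real_derivative tan (\<Theta> x)) (at x)" if x: "x \<in> ?I" for x
  proof -
    obtain t where t: "t \<in> ?S" "x = U t" using onto[OF x] by auto
    have "(V has_real_derivative W t) (at (\<Theta> x))" using dV[OF t(1)] \<Theta>U t by simp
    then have "(\<phi> has_real_derivative W t * inverse (K t)) (at x)"
      unfolding \<phi>_def using d\<Theta>[OF t(1)] t(2) by (intro DERIV_chain2) auto
    moreover have "W t * inverse (K t) = tan t"
    proof -
      have d: "c * cos t + g t \<noteq> 0" using denom[of t] t(1) by auto
      have "W t * inverse (K t) = f t * sin t / (f t * cos t)"
        unfolding W_def K_def transit_density_def using d by (simp add: inverse_eq_divide)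
      also have "\<dots> = tan t" using pos(1)[of t] by (simp add: tan_def)
      finally show ?thesis .
    qed
    ultimately show ?thesis using \<Theta>U t by simp
  qed
  have dtan: "((\<lambda>x. tan (\<Theta> x)) has_real_derivative slope_speed a b c (tan (\<Theta> x))) (at x)"
    and speed: "0 < slope_speed a b c (tan (\<Theta> x))" if x: "x \<in> ?I" for x
  proof -
    obtain t where t: "t \<in> ?S" "x = U t" using onto[OF x] by auto
    have C: "0 < cos t" using cos t by auto
    have "1 + (tan t)\<^sup>2 = (inverse (cos t))\<^sup>2" using C by (intro tan_sec) auto
    moreover from this have "sqrt (1 + (tan t)\<^sup>2) = inverse (cos t)"
      using C by simp
    moreover have "arctan (tan t) = t" using t \<alpha> by (intro arctan_tan) auto
    ultimately have "slope_speed a b c (tan t) =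
        (inverse (cos t))\<^sup>2 * (c + g t * inverse (cos t)) / f t"
      unfolding slope_speed_def a b by simp
    also have "c + g t * inverse (cos t) = (c * cos t + g t) / cos t"
      using C by (simp add: field_simps)
    finally have eq: "slope_speed a b c (tan t) = inverse ((cos t)\<^sup>2) * inverse (K t)"
      unfolding K_def transit_density_def by (simp add: field_simps)
    have "(tan has_real_derivative inverse ((cos t)\<^sup>2)) (at (\<Theta> x))"
      using C \<Theta>U t by simp
    then have "((\<lambda>x. tan (\<Theta> x)) has_real_derivative inverse ((cos t)\<^sup>2) * inverse (K t)) (at x)"
      using d\<Theta>[OF t(1)] t(2) by (intro DERIV_chain2) auto
    then show "((\<lambda>x. tan (\<Theta> x)) has_real_derivative slope_speed a b c (tan (\<Theta> x))) (at x)"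
      using eq \<Theta>U t by simp
    show "0 < slope_speed a b c (tan (\<Theta> x))" using eq \<Theta>U t C Kpos[OF t(1)] by simp
  qed
  have deriv\<phi>: "deriv \<phi> x = tan (\<Theta> x)" if "x \<in> ?I" for x
    using d\<phi>[OF that] by (rule DERIV_imp_deriv)
  have "crosses (slope_speed a b c) h (deriv \<phi>)"
  proof (rule strict_mono_onto_imp_crosses)
    fix x assume x: "x \<in> ?I"
    have "(deriv \<phi> has_real_derivative slope_speed a b c (tan (\<Theta> x))) (at x)"
      by (rule has_field_derivative_transform_within_open[OF dtan[OF x], of ?I])
        (use x deriv\<phi> in auto)
    then show "(deriv \<phi> has_real_derivative slope_speed a b c (deriv \<phi> x)) (at x)"
      using deriv\<phi>[OF x] by simp
  next
    show "strict_mono_on ?I (deriv \<phi>)"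
    proof (rule strict_mono_onI)
      fix y z :: real assume yz: "y \<in> ?I" "z \<in> ?I" "y < z"
      have "tan (\<Theta> y) < tan (\<Theta> z)"
      proof (rule DERIV_pos_imp_increasing[OF yz(3)])
        fix x assume "y \<le> x" "x \<le> z"
        then have "x \<in> ?I" using yz by auto
        then show "\<exists>D. ((\<lambda>x. tan (\<Theta> x)) has_real_derivative D) (at x) \<and> 0 < D"
          using dtan speed by blast
      qed
      then show "deriv \<phi> y < deriv \<phi> z" using deriv\<phi> yz by simp
    qed
  next
    have "deriv \<phi> ` ?I = tan ` ?S"
    proof (intro equalityI subsetI)
      fix y assume "y \<in> deriv \<phi> ` ?I"
      then obtain x where x: "x \<in> ?I" "y = tan (\<Theta> x)" using deriv\<phi> by auto
      then show "y \<in> tan ` ?S" using onto[OF x(1)] \<Theta>U by auto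
    next
      fix y assume "y \<in> tan ` ?S"
      then obtain t where t: "t \<in> ?S" "y = tan t" by auto
      then have "y = deriv \<phi> (U t)" using deriv\<phi>[OF UI] \<Theta>U by simp
      then show "y \<in> deriv \<phi> ` ?I" using UI[OF t(1)] by blast
    qed
    also have "\<dots> = {y. \<bar>arctan y\<bar> < \<alpha>}"
    proof (intro equalityI subsetI)
      fix y assume "y \<in> tan ` ?S"
      then obtain t where t: "t \<in> ?S" "y = tan t" by auto
      moreover have "arctan (tan t) = t" using t \<alpha> by (intro arctan_tan) auto
      ultimately show "y \<in> {y. \<bar>arctan y\<bar> < \<alpha>}" by auto
    next
      fix y assume "y \<in> {y. \<bar>arctan y\<bar> < \<alpha>}"
      then show "y \<in> tan ` ?S" by (intro image_eqI[of _ _ "arctan y"]) (auto simp: tan_arctan)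
    qed
    finally show "deriv \<phi> ` ?I = {y. - h < ereal y \<and> ereal y < h}" using h by simp
  qed
  moreover have "\<forall>x\<in>?I. \<phi> differentiable at x" 
    using d\<phi> real_differentiable_def by blast
  moreover have "0 < a y" for y using a pos by simp
  ultimately show ?thesis by (auto simp: solves_P_iff_crosses)
qed

section \<open>Functions of the graph normal\<close>

lemma graph_normal_angle:
  "graph_normal y = (cos (arctan y + pi / 2), sin (arctan y + pi / 2))"
proof -
  have "cos (arctan y + pi / 2) = - sin (arctan y)" "sin (arctan y + pi / 2) = cos (arctan y)"
    by (simp_all only: cos_add sin_add cos_pi_half sin_pi_half mult_zero_right mult_1_right
        diff_0 add_0_left)
  then show ?thesis by (simp add: graph_normal_def sin_arctan cos_arctan)
qed

lemma smooth_on_circle_differentiable: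
  assumes "smooth_on_circle F"
  shows "(\<lambda>s. F (cos s, sin s)) differentiable at t"
proof -
  have "(deriv ^^ 0) (\<lambda>s. F (cos s, sin s)) differentiable at t"
    using assms unfolding smooth_on_circle_def by blast
  then show ?thesis by (simp only: funpow_0)
qed

text \<open>
  Supremum and infimum over \<open>\<real>\<close> are only meaningful as bounds on a bounded range.  Boundedness comes from the
  compact interval of all angles, vertical ones included.
\<close>
lemma bounded_range_arctan:
  fixes f :: "real \<Rightarrow> real"
  assumes "continuous_on UNIV f"
  shows "bounded (range (\<lambda>y. f (arctan y)))"
proof (rule bounded_subset)
  show "bounded (f ` {- (pi / 2)..pi / 2})"
    by (intro compact_imp_bounded compact_continuous_image continuous_on_subset[OF assms]) auto
  show "range (\<lambda>y. f (arctan y)) \<subseteq> f ` {- (pi / 2)..pi / 2}"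
    using arctan_bounded by (auto intro!: imageI simp: less_imp_le)
qed

theorem theorem1p1:
  fixes A B :: "real \<times> real \<Rightarrow> real"
    and a b :: "real \<Rightarrow> real"
    and a_max a_min b_min :: real
  assumes "smooth_on_circle A" and "\<forall>z\<in>sphere 0 1. A z > 0"
    and "smooth_on_circle (\<lambda>z. - B z)" and "\<forall>z\<in>sphere 0 1. - B z > 0"
    and "a = (\<lambda>p. A (graph_normal p))"
    and "b = (\<lambda>p. B (graph_normal p))"
    and "a_max = (SUP p. a p)" and "a_min = (INF p. a p)" and "b_min = (INF p. b p)"
    and "\<forall>p. a p > 0 \<and> 0 > b p"
  shows
    "(a_min > - b_min \<longrightarrow>
       (\<exists>c \<Phi>. solves_P a b \<infinity> c \<Phi> \<and> 0 < c \<and> c < pi * a_max / 2 \<and>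
          (\<forall>c' \<phi>. solves_P a b \<infinity> c' \<phi> \<longrightarrow> c' = c \<and> equal_up_to_shift \<phi> \<Phi>)))
     \<and>
     (let H = {h::real. 0 < h \<and> a_min * h > - b_min * sqrt (1 + h\<^sup>2)} in
       \<exists>(c :: real \<Rightarrow> real) (\<Phi> :: real \<Rightarrow> real \<Rightarrow> real).
          strict_mono_on H c \<and>
          (\<forall>h\<in>H. solves_P a b (ereal h) (c h) (\<Phi> h) \<and>
             0 < c h \<and> c h < a_max * arctan h \<and>
             (\<forall>c' \<phi>. solves_P a b (ereal h) c' \<phi> \<longrightarrow>
                c' = c h \<and> equal_up_to_shift \<phi> (\<Phi> h))))"
proof -
  define f where "f = (\<lambda>t. A (cos (t + pi / 2), sin (t + pi / 2)))"
  define g where "g = (\<lambda>t. - B (cos (t + pi / 2), sin (t + pi / 2)))"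
  have a: "a y = f (arctan y)" and b: "b y = - g (arctan y)" for y
    by (simp_all add: assms(5,6) f_def g_def graph_normal_angle)
  have pos: "0 < f t" "0 < g t" for t
    using assms(2,4) by (auto simp: f_def g_def norm_prod_def)
  have df: "f differentiable at t" and dg: "g differentiable at t" for t
  proof -
    have "(\<lambda>t. F (cos (t + pi / 2), sin (t + pi / 2))) differentiable at t"
      if "smooth_on_circle F" for F
      by (rule differentiable_compose[of "\<lambda>s. F (cos s, sin s)"])
        (use smooth_on_circle_differentiable[OF that] in auto)
    from this[OF assms(1)] this[OF assms(3)]
    show "f differentiable at t" "g differentiable at t" by (auto simp: f_def g_def)
  qed
  have cont: "continuous_on UNIV f" "continuous_on UNIV g"
    using df dg by (auto intro!: continuous_at_imp_continuous_on differentiable_imp_continuous_within)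
  have darctan: "arctan differentiable at y" for y
    using DERIV_arctan real_differentiable_def by blast
  have ab: "a differentiable at y" "b differentiable at y" "0 < a y" for y
  proof -
    have "(\<lambda>y. f (arctan y)) differentiable at y" "(\<lambda>y. - g (arctan y)) differentiable at y"
      using differentiable_compose[OF df darctan]
        differentiable_minus[OF differentiable_compose[OF dg darctan]] by blast+
    then show "a differentiable at y" "b differentiable at y"
      by (simp_all only: a[abs_def] b[abs_def])
  qed (use a pos in simp)
  have "bounded (range a)"
    using bounded_range_arctan[OF cont(1)] by (simp add: a)
  then have a_bd: "a_min \<le> a y" "a y \<le> a_max" for y
    unfolding assms(7,8)
    by (auto intro!: cINF_lower cSUP_upper bounded_imp_bdd_below bounded_imp_bdd_above)
  have "bounded (range b)"
    using bounded_range_arctan[of "\<lambda>t. - g t"] cont by (simp add: b continuous_on_minus)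
  then have b_bd: "b_min \<le> b y" for y
    unfolding assms(9) by (auto intro!: cINF_lower bounded_imp_bdd_below)
  have bounds: "a_min \<le> f t \<and> f t \<le> a_max \<and> g t \<le> - b_min" if "\<bar>t\<bar> < pi / 2" for t
  proof -
    have "arctan (tan t) = t" using that by (intro arctan_tan) auto
    then show ?thesis using a_bd[of "tan t"] b_bd[of "tan t"] by (simp add: a b)
  qed
  \<comment> \<open>Whichever of the two has the larger \<open>c\<close> plays the faster crossing.\<close>
  have unique: "c' = c \<and> equal_up_to_shift \<phi> \<Phi>"
    if "solves_P a b h c \<Phi>" "solves_P a b h c' \<phi>" "0 < h" for h c c' \<phi> \<Phi>
  proof (cases "c \<le> c'")
    case True
    then show ?thesis using solution_comparison[OF that(2,1,3) order_refl True ab] by simp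
  next
    case False
    then show ?thesis
      using solution_comparison[OF that(1,2,3) order_refl _ ab] by simp
  qed
  have exist: "\<exists>c \<Phi>. solves_P a b h c \<Phi> \<and> 0 < c \<and> c < a_max * \<alpha>"
    if \<alpha>: "0 < \<alpha>" "\<alpha> \<le> pi / 2" and key: "- b_min < a_min * sin \<alpha>"
      and h: "\<And>y. (- h < ereal y \<and> ereal y < h) \<longleftrightarrow> \<bar>arctan y\<bar> < \<alpha>" for \<alpha> h
  proof -
    obtain c where c: "0 < c" "c < a_max * \<alpha>"
      "integral {-\<alpha>..\<alpha>} (transit_density f g c) = 2"
      using exists_speed_with_transit_time_two[OF cont pos \<alpha> bounds key] by blast
    then show ?thesis
      using exists_solution_of_transit_time_two[OF cont pos \<alpha> h _ c(3) a b] by auto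
  qed
  have part1: "\<exists>c \<Phi>. solves_P a b \<infinity> c \<Phi> \<and> 0 < c \<and> c < pi * a_max / 2 \<and>
          (\<forall>c' \<phi>. solves_P a b \<infinity> c' \<phi> \<longrightarrow> c' = c \<and> equal_up_to_shift \<phi> \<Phi>)"
    if "a_min > - b_min"
  proof -
    have "\<exists>c \<Phi>. solves_P a b \<infinity> c \<Phi> \<and> 0 < c \<and> c < a_max * (pi / 2)"
    proof (rule exist)
      show "- b_min < a_min * sin (pi / 2)" using that by simp
      have "\<bar>arctan y\<bar> < pi / 2" for y using arctan_bounded[of y] by linarith
      then show "(- \<infinity> < ereal y \<and> ereal y < \<infinity>) = (\<bar>arctan y\<bar> < pi / 2)" for y by simp
    qed simp_all
    then obtain c \<Phi> where "solves_P a b \<infinity> c \<Phi>" "0 < c" "c < a_max * (pi / 2)" by blast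
    then show ?thesis using unique by (intro exI[of _ c] exI[of _ \<Phi>]) (auto simp: mult.commute)
  qed
  define H where "H = {h::real. 0 < h \<and> a_min * h > - b_min * sqrt (1 + h\<^sup>2)}"
  have "\<exists>c \<Phi>. solves_P a b (ereal h) c \<Phi> \<and> 0 < c \<and> c < a_max * arctan h" if "h \<in> H" for h
  proof (rule exist)
    have sq: "0 < sqrt (1 + h\<^sup>2)" by (simp add: add_pos_nonneg)
    show "0 < arctan h" using that by (simp add: H_def)
    show "arctan h \<le> pi / 2" using arctan_ubound[of h] by simp
    show "- b_min < a_min * sin (arctan h)"
      using that sq by (simp add: H_def sin_arctan field_simps)
    show "(- ereal h < ereal y \<and> ereal y < ereal h) = (\<bar>arctan y\<bar> < arctan h)" for y
      using arctan_less_iff[of "-h" y] arctan_less_iff[of y h] by (auto simp: arctan_minus)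
  qed
  then obtain c \<Phi> where sol: "\<And>h. h \<in> H \<Longrightarrow>
      solves_P a b (ereal h) (c h) (\<Phi> h) \<and> 0 < c h \<and> c h < a_max * arctan h"
    by metis
  have "strict_mono_on H c"
  proof (rule strict_mono_onI, rule ccontr)
    fix h1 h2 assume h: "h1 \<in> H" "h2 \<in> H" "h1 < h2" and "\<not> c h1 < c h2"
    then have "ereal h1 = ereal h2"
      using solution_comparison[of a b h1 "c h1" "\<Phi> h1" h2 "c h2" "\<Phi> h2"] sol ab
      by (auto simp: H_def)
    then show False using h by simp
  qed
  moreover have "\<forall>h\<in>H. solves_P a b (ereal h) (c h) (\<Phi> h) \<and> 0 < c h \<and> c h < a_max * arctan h \<and>
      (\<forall>c' \<phi>. solves_P a b (ereal h) c' \<phi> \<longrightarrow> c' = c h \<and> equal_up_to_shift \<phi> (\<Phi> h))"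
  proof (intro ballI conjI allI)
    fix h c' \<phi> assume h: "h \<in> H"
    then have pos_h: "0 < ereal h" by (simp add: H_def)
    show "solves_P a b (ereal h) (c h) (\<Phi> h)" "0 < c h" "c h < a_max * arctan h"
      using sol[OF h] by auto
    show "solves_P a b (ereal h) c' \<phi> \<longrightarrow> c' = c h \<and> equal_up_to_shift \<phi> (\<Phi> h)"
      using unique[OF _ _ pos_h] sol[OF h] by blast
  qed
  ultimately show ?thesis using part1 unfolding Let_def H_def[symmetric] by blast
qed

end
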